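(* Let $d\ge2$, $\Omega\subset\mathbb R^d$ a bounded Lipschitz polytope, $\mathcal T$ a conforming simplicial mesh of $\Omega$ with set of facets $\mathcal F$, and let $k=1$. Then the Crouzeix–Raviart facet functions are given, for $F\in\mathcal F$, by $$B_1^{\mathrm{CR},F}=\begin{cases}P_1^{(0,d-2)}(1-2\lambda_{K,F})&\text{on each }K\in\mathcal T_F,\\0&\text{otherwise},\end{cases}$$ and with the functionals $J_0^F(u)=\frac1{|F|}\int_F u$, $F\in\mathcal F$, they form a bidual system: $$J_0^F\bigl(B_1^{\mathrm{CR},F'}\bigr)=\delta_{F,F'}\qquad\forall F,F'\in\mathcal F.$$
   Context: A conforming simplicial mesh is a finite set of closed nondegenerate $d$-simplices with union $\overline\Omega$ such that any two intersect in the empty set or a common face; $\mathcal F$ is the set of its $(d-1)$-dimensional facets, $\mathcal T_F=\{K\in\mathcal T:F\subset K\}$. $\lambda_{K,\mathbf z}$ is the barycentric coordinate of $K$ for the vertex $\mathbf z$; $\lambda_{K,F}$ is that of the vertex of $K$ opposite to $F$. $P_n^{(\alpha,\beta)}$ is the Jacobi polynomial of degree $n$, orthogonal on $[-1,1]$ with respect to $(1-x)^\alpha(1+x)^\beta$ to polynomials of degree $<n$, normalized by $P_n^{(\alpha,\beta)}(1)=(\alpha+1)_n/n!$ with $(a)_n=a(a+1)\cdots(a+n-1)$. The general definition of the non-conforming functions of order $k$ is: $B_k^{\mathrm{CR},K}=\frac1d\bigl(-1+\sum_{\mathbf z}P_k^{(0,d-2)}(1-2\lambda_{K,\mathbf z})\bigr)$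 on $K$ (sum over the vertices of $K$) and $0$ elsewhere; $B_k^{\mathrm{CR},F}=P_k^{(0,d-2)}(1-2\lambda_{K,F})-B_k^{\mathrm{CR},K}$ on each $K\in\mathcal T_F$ and $0$ elsewhere. In $J_0^F(B_1^{\mathrm{CR},F'})$ the trace on $F$ may be taken from any simplex $K\in\mathcal T_F$. *)

theory Defs
  imports "HOL-Analysis.Analysis" "HOL-Computational_Algebra.Polynomial"
begin

section \<open>Domains and meshes\<close>

text \<open>Near each boundary point a Lipschitz set is the strict epigraph, in some direction \<open>e\<close>, of a
  Lipschitz function on the hyperplane orthogonal to \<open>e\<close>. Neither connectedness nor convexity is
  required; the library predicate \<^const>\<open>polytope\<close> means convex polytope, so a general
  polytope is a finite union of those.\<close>

definition lipschitz_boundary :: "(real^'n) set \<Rightarrow> bool" where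
  "lipschitz_boundary \<Omega> \<longleftrightarrow>
     (\<forall>x\<in>frontier \<Omega>. \<exists>U e L \<phi>.
        open U \<and> x \<in> U \<and> norm e = 1 \<and>
        lipschitz_on L {y. y \<bullet> e = 0} (\<phi> :: real^'n \<Rightarrow> real) \<and>
        \<Omega> \<inter> U = {y \<in> U. \<phi> (y - (y \<bullet> e) *\<^sub>R e) < y \<bullet> e})"

definition bounded_lipschitz_polytope :: "(real^'n) set \<Rightarrow> bool" where
  "bounded_lipschitz_polytope \<Omega> \<longleftrightarrow>
     open \<Omega> \<and> bounded \<Omega> \<and> lipschitz_boundary \<Omega> \<and>
     (\<exists>\<P>. finite \<P> \<and> (\<forall>P\<in>\<P>. polytope P) \<and> closure \<Omega> = \<Union>\<P>)"

text \<open>The empty set is a face of every set for \<^const>\<open>face_of\<close>, so the last conjunct covers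
  disjoint simplices as well.\<close>

definition conforming_simplicial_mesh :: "(real^'n) set \<Rightarrow> (real^'n) set set \<Rightarrow> bool" where
  "conforming_simplicial_mesh \<Omega> \<T> \<longleftrightarrow>
     finite \<T> \<and> (\<forall>K\<in>\<T>. int CARD('n) simplex K) \<and> \<Union>\<T> = closure \<Omega> \<and>
     (\<forall>K\<in>\<T>. \<forall>K'\<in>\<T>. (K \<inter> K') face_of K \<and> (K \<inter> K') face_of K')"

definition mesh_facets :: "(real^'n) set set \<Rightarrow> (real^'n) set set" where
  "mesh_facets \<T> = {F. \<exists>K\<in>\<T>. F facet_of K}"

definition simplices_at :: "(real^'n) set set \<Rightarrow> (real^'n) set \<Rightarrow> (real^'n) set set" where
  "simplices_at \<T> F = {K \<in> \<T>. F \<subseteq> K}"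


section \<open>Barycentric coordinates\<close>

definition vertices :: "(real^'n) set \<Rightarrow> (real^'n) set" where
  "vertices K = {z. z extreme_point_of K}"

text \<open>For a nondegenerate simplex of full dimension the weights exist and are unique for every point
  of the space, so \<open>\<lambda>\<^sub>K\<^sub>,\<^sub>z\<close> is an affine function on the whole space.\<close>

definition barycentric :: "(real^'n) set \<Rightarrow> real^'n \<Rightarrow> real^'n \<Rightarrow> real" where
  "barycentric K z x =
     (THE u. (\<forall>v. v \<notin> vertices K \<longrightarrow> u v = 0) \<and>
             (\<Sum>v\<in>vertices K. u v) = 1 \<and> (\<Sum>v\<in>vertices K. u v *\<^sub>R v) = x) z"

definition opposite_vertex :: "(real^'n) set \<Rightarrow> (real^'n) set \<Rightarrow> real^'n" where
  "opposite_vertex K F = (THE z. z \<in> vertices K \<and> z \<notin> F)"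

definition barycentric_facet :: "(real^'n) set \<Rightarrow> (real^'n) set \<Rightarrow> real^'n \<Rightarrow> real" where
  "barycentric_facet K F = barycentric K (opposite_vertex K F)"


section \<open>Jacobi polynomials\<close>

text \<open>Meaningful for \<open>\<alpha>, \<beta> > -1\<close>.\<close>

definition jacobi_poly :: "nat \<Rightarrow> real \<Rightarrow> real \<Rightarrow> real poly" where
  "jacobi_poly n \<alpha> \<beta> =
     (THE p. degree p = n \<and>
        (\<forall>q. degree q < n \<longrightarrow>
           ((\<lambda>x. (1 - x) powr \<alpha> * (1 + x) powr \<beta> * poly p x * poly q x) has_integral 0) {-1..1}) \<and>
        poly p 1 = pochhammer (\<alpha> + 1) n / fact n)"


section \<open>Non-conforming Crouzeix--Raviart functions\<close>

text \<open>The functions are discontinuous across facets, so they are represented by their pieces: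
  \<open>u K\<close> is the restriction of the piecewise polynomial \<open>u\<close> to the closed simplex \<open>K\<close> of the mesh.
  Its values on a facet of \<open>K\<close> are the trace taken from \<open>K\<close>, and only its values on \<open>K\<close> matter.\<close>

type_synonym 'n broken_function = "(real^'n) set \<Rightarrow> real^'n \<Rightarrow> real"

definition CR_jacobi :: "nat \<Rightarrow> nat \<Rightarrow> real \<Rightarrow> real" where
  "CR_jacobi d k = poly (jacobi_poly k 0 (real d - 2))"

definition CR_simplex :: "nat \<Rightarrow> (real^'n) set \<Rightarrow> 'n broken_function" where
  "CR_simplex k K K' x =
     (if K' = K
      then 1 / real CARD('n) *
           (- 1 + (\<Sum>z\<in>vertices K. CR_jacobi CARD('n) k (1 - 2 * barycentric K z x)))
      else 0)"

definition CR_facet ::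
    "(real^'n) set set \<Rightarrow> nat \<Rightarrow> (real^'n) set \<Rightarrow> 'n broken_function" where
  "CR_facet \<T> k F K x =
     (if K \<in> simplices_at \<T> F
      then CR_jacobi CARD('n) k (1 - 2 * barycentric_facet K F x) - CR_simplex k K K x
      else 0)"


section \<open>Facet means\<close>

text \<open>Surface measure on the affine hull of \<open>S\<close>: the product Lebesgue measure transported by the
  isometry \<open>c \<mapsto> a + (\<Sum>b\<in>B. c b *\<^sub>R b)\<close>, where \<open>a\<close> lies in \<open>affine hull S\<close> and \<open>B\<close> is an
  orthonormal basis of its direction space. It does not depend on the choice of \<open>a\<close> and \<open>B\<close>. If \<open>S\<close>
  is a facet, \<open>B\<close> has \<open>d - 1\<close> elements.\<close>

definition surface_measure :: "(real^'n) set \<Rightarrow> (real^'n) measure" where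
  "surface_measure S =
     (let a = (SOME a. a \<in> affine hull S);
          B = (SOME B. pairwise orthogonal B \<and> (\<forall>b\<in>B. norm b = 1) \<and>
                 span B = {x - y | x y. x \<in> affine hull S \<and> y \<in> affine hull S})
      in distr (\<Pi>\<^sub>M b\<in>B. lborel) borel (\<lambda>c. a + (\<Sum>b\<in>B. c b *\<^sub>R b)))"

definition facet_mean :: "(real^'n) set \<Rightarrow> (real^'n \<Rightarrow> real) \<Rightarrow> real" where
  "facet_mean F u = 1 / measure (surface_measure F) F * (LINT x:F|surface_measure F. u x)"

end

(* For k = 1 the Jacobi polynomial is 1 + d (x - 1) / 2, so each P_1(1 - 2 lambda) is 1 - d lambda,
   and the simplex function vanishes because the d + 1 barycentric coordinates sum to 1. On a facet
   the coordinate of the opposite vertex is 0, whereas the mean of the coordinate of any of its own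
   d vertices is 1 / d. The latter follows from the behaviour of the surface measure under a
   homothety centred at that vertex. *)

theory Submission
  imports Defs
begin


subsection \<open>Barycentric coordinates of a full-dimensional simplex\<close>

text \<open>The chart behind the surface measure is an arbitrary choice, unrelated to the vertices
  of the facet, so integrals are not evaluated in coordinates. A homothety has the same ratio t
  along every axis of any orthonormal chart, so its effect on the measure reduces to scaling
  Lebesgue measure on the line. An affine map exchanging two vertices, which would give equal means
  by symmetry, mixes the axes in general. Let m = d - 1, M the measure of the facet and I the
  integral over it of the coordinate of its vertex w. The homothety with centre w and ratio t < 1
  gives I * (1 - t^(m+1)) = t^m * (1 - t) * M + R with 0 \<le> R \<le> (1 - t) * (1 - t^m) * M.
  Dividing by 1 - t and letting t tend to 1 yields (m + 1) * I = M, which is the origin of 1 /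
  d.\<close>

locale full_simplex =
  fixes C :: "(real^'n) set"
  assumes indep: "\<not> affine_dependent C" and card_vertices: "card C = CARD('n) + 1"
begin

lemma finite_vertices: "finite C"
  using indep by (rule aff_independent_finite)

lemma vertices_eq: "vertices (convex hull C) = C"
  by (simp add: vertices_def extreme_point_of_convex_hull_affine_independent indep)

lemma affine_combination_unique:
  assumes "sum u C = 1" "sum w C = 1" "(\<Sum>v\<in>C. u v *\<^sub>R v) = (\<Sum>v\<in>C. w v *\<^sub>R v)" "v \<in> C"
  shows "u v = w v"
proof (rule ccontr)
  assume "u v \<noteq> w v"
  moreover have "(\<Sum>v\<in>C. u v - w v) = 0" "(\<Sum>v\<in>C. (u v - w v) *\<^sub>R v) = 0"
    using assms by (simp_all add: sum_subtractf scaleR_diff_left)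
  ultimately have "affine_dependent C"
    using \<open>v \<in> C\<close> affine_dependent_explicit_finite[OF finite_vertices]
    by (intro iffD2[OF affine_dependent_explicit_finite[OF finite_vertices]] exI[of _ "\<lambda>v. u v - w v"])
       auto
  then show False
    using indep by simp
qed

text \<open>Affine independence makes the weights unique, so exhibiting any weights of sum 1 that
  represent x determines the coordinates. Their signs are unrestricted: x may lie outside the
  simplex.\<close>

lemma barycentric_eq:
  assumes "sum u C = 1" "(\<Sum>v\<in>C. u v *\<^sub>R v) = x" "z \<in> C"
  shows "barycentric (convex hull C) z x = u z"
proof -
  \<comment> \<open>The definite description ranges over functions on the whole space that vanish
    off the vertices, hence the extension by zero.\<close>
  define w where "w = (\<lambda>v. if v \<in> C then u v else 0)"
  have w: "sum w C = 1" "(\<Sum>v\<in>C. w v *\<^sub>R v) = x"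
    using assms by (simp_all add: w_def)
  have "(THE u. (\<forall>v. v \<notin> C \<longrightarrow> u v = 0) \<and> sum u C = 1 \<and> (\<Sum>v\<in>C. u v *\<^sub>R v) = x) = w"
  proof (rule the_equality)
    fix u' assume u': "(\<forall>v. v \<notin> C \<longrightarrow> u' v = 0) \<and> sum u' C = 1 \<and> (\<Sum>v\<in>C. u' v *\<^sub>R v) = x"
    show "u' = w"
    proof
      fix v show "u' v = w v"
        using u' w affine_combination_unique[of u' w v] by (cases "v \<in> C") (auto simp: w_def)
    qed
  qed (use w in \<open>auto simp: w_def\<close>)
  then show ?thesis
    using \<open>z \<in> C\<close> by (simp add: barycentric_def vertices_eq w_def)
qed

text \<open>The affine hull of d + 1 affinely independent points is the whole space, so weights
  exist for every x.\<close>

lemma sum_barycentric: "(\<Sum>z\<in>C. barycentric (convex hull C) z x) = 1" (is ?sum)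
  and barycentric_combination: "(\<Sum>z\<in>C. barycentric (convex hull C) z x *\<^sub>R z) = x" (is ?comb)
proof -
  have "x \<in> affine hull C"
    by (simp add: affine_independent_span_eq indep card_vertices)
  then obtain u where u: "sum u C = 1" "(\<Sum>v\<in>C. u v *\<^sub>R v) = x"
    by (auto simp: affine_hull_finite finite_vertices)
  then show ?sum ?comb
    by (simp_all add: barycentric_eq[OF u] cong: sum.cong)
qed

lemma barycentric_vertex:
  assumes "z \<in> C" "v \<in> C"
  shows "barycentric (convex hull C) z v = (if z = v then 1 else 0)"
  using assms finite_vertices
  by (subst barycentric_eq[of "\<lambda>z. if z = v then 1 else 0"]) (auto simp: if_distrib[of "\<lambda>c. c *\<^sub>R _"] cong: if_cong)

text \<open>The combined weights again have sum 1 and represent the combined point. Three points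
  serve two purposes: coefficients 1, 1, -1 give additivity relative to the value at 0, and c = 0
  covers scaling and homotheties.\<close>

lemma barycentric_affine:
  assumes "z \<in> C" "a + b + c = 1"
  shows "barycentric (convex hull C) z (a *\<^sub>R x + b *\<^sub>R y + c *\<^sub>R w) =
    a * barycentric (convex hull C) z x + b * barycentric (convex hull C) z y
    + c * barycentric (convex hull C) z w"
proof (rule barycentric_eq)
  show "(\<Sum>z\<in>C. a * barycentric (convex hull C) z x + b * barycentric (convex hull C) z y
    + c * barycentric (convex hull C) z w) = 1"
    using assms by (simp add: sum.distrib sum_barycentric flip: sum_distrib_left)
  show "(\<Sum>z\<in>C. (a * barycentric (convex hull C) z x + b * barycentric (convex hull C) z y
    + c * barycentric (convex hull C) z w) *\<^sub>R z) = a *\<^sub>R x + b *\<^sub>R y + c *\<^sub>R w"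
    by (simp add: sum.distrib scaleR_add_left barycentric_combination
        flip: scaleR_scaleR scaleR_sum_right)
qed fact

lemma barycentric_homothety:
  assumes "z \<in> C"
  shows "barycentric (convex hull C) z (w + t *\<^sub>R (x - w)) =
    t * barycentric (convex hull C) z x + (1 - t) * barycentric (convex hull C) z w"
  using barycentric_affine[OF assms, of t "1 - t" 0 x w 0] by (simp add: algebra_simps)

lemma continuous_on_barycentric:
  assumes "z \<in> C"
  shows "continuous_on S (barycentric (convex hull C) z)"
proof -
  let ?l = "barycentric (convex hull C) z"
  have "linear (\<lambda>x. ?l x - ?l 0)"
  proof (rule linearI)
    fix x y show "?l (x + y) - ?l 0 = ?l x - ?l 0 + (?l y - ?l 0)"
      using barycentric_affine[OF assms, of 1 1 "-1" x y 0] by simp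
  next
    fix r x show "?l (r *\<^sub>R x) - ?l 0 = r *\<^sub>R (?l x - ?l 0)"
      using barycentric_affine[OF assms, of r "1 - r" 0 x 0 0] by (simp add: algebra_simps)
  qed
  then have "continuous_on S (\<lambda>x. (?l x - ?l 0) + ?l 0)"
    by (intro continuous_on_add continuous_on_const linear_continuous_on)
      (simp add: linear_conv_bounded_linear)
  then show ?thesis
    by simp
qed

text \<open>By uniqueness, the weights of a convex combination of D, padded by zeros, are the
  coordinates over C. Membership thus becomes a set of sign conditions, which a homothety centred at
  a vertex transforms one coordinate at a time.\<close>

lemma mem_face_iff:
  assumes "D \<subseteq> C"
  shows "x \<in> convex hull D \<longleftrightarrow>
    (\<forall>v\<in>C. 0 \<le> barycentric (convex hull C) v x) \<and> (\<forall>v\<in>C - D. barycentric (convex hull C) v x = 0)"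
    (is "_ \<longleftrightarrow> ?R")
proof
  have finD: "finite D"
    using assms finite_vertices by (rule finite_subset)
  {
    assume "x \<in> convex hull D"
    then obtain u where u: "\<forall>v\<in>D. 0 \<le> u v" "sum u D = 1" "(\<Sum>v\<in>D. u v *\<^sub>R v) = x"
      by (auto simp: convex_hull_finite finD)
    define w where "w = (\<lambda>v. if v \<in> D then u v else 0)"
    have "sum w C = sum w D" "(\<Sum>v\<in>C. w v *\<^sub>R v) = (\<Sum>v\<in>D. w v *\<^sub>R v)"
      using assms finite_vertices by (intro sum.mono_neutral_right; auto simp: w_def)+
    then have "sum w C = 1" "(\<Sum>v\<in>C. w v *\<^sub>R v) = x"
      using u by (simp_all add: w_def)
    then have "\<And>v. v \<in> C \<Longrightarrow> barycentric (convex hull C) v x = w v"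
      by (rule barycentric_eq)
    then show ?R
      using u by (auto simp: w_def)
  }
  {
    assume R: ?R
    have "(\<Sum>v\<in>D. barycentric (convex hull C) v x) = (\<Sum>v\<in>C. barycentric (convex hull C) v x)"
      "(\<Sum>v\<in>D. barycentric (convex hull C) v x *\<^sub>R v) = (\<Sum>v\<in>C. barycentric (convex hull C) v x *\<^sub>R v)"
      using assms finite_vertices R by (intro sum.mono_neutral_left; auto)+
    then have "(\<forall>v\<in>D. 0 \<le> barycentric (convex hull C) v x) \<and> (\<Sum>v\<in>D. barycentric (convex hull C) v x) = 1
        \<and> (\<Sum>v\<in>D. barycentric (convex hull C) v x *\<^sub>R v) = x"
      using R assms by (auto simp: sum_barycentric barycentric_combination)
    then show "x \<in> convex hull D"
      unfolding convex_hull_finite[OF finD]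
      by (intro CollectI exI[of _ "\<lambda>v. barycentric (convex hull C) v x"])
  }
qed

lemma opposite_vertex_eq:
  assumes "u \<in> C"
  shows "opposite_vertex (convex hull C) (convex hull (C - {u})) = u"
  unfolding opposite_vertex_def vertices_eq
proof (rule the_equality)
  show "u \<in> C \<and> u \<notin> convex hull (C - {u})"
    using assms by (simp add: mem_face_iff barycentric_vertex)
qed (use assms in \<open>auto intro: hull_inc\<close>)

end


subsection \<open>The Jacobi polynomial of degree one\<close>

text \<open>Expanding the linear factor at -1 turns its product with the weight into a sum of powers
  of 1 + x. The factor c stands for a constant test polynomial.\<close>

lemma has_integral_jacobi_weight_linear:
  "((\<lambda>x. (1 - x) powr 0 * (1 + x) powr real n * (a + b * (1 + x)) * c) has_integral
     c * (a * 2 ^ (n + 1) / (n + 1) + b * 2 ^ (n + 2) / (n + 2))) {-1..1}"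
proof -
  let ?G = "\<lambda>x::real. c * (a * (1 + x) ^ (n + 1) / (n + 1) + b * (1 + x) ^ (n + 2) / (n + 2))"
  have "((\<lambda>x. (1 + x) ^ n * (a + b * (1 + x)) * c) has_integral ?G 1 - ?G (-1)) {-1..1}"
  proof (rule fundamental_theorem_of_calculus)
    fix x :: real
    have "(?G has_real_derivative
        c * (a * (real (n + 1) * (1 + x) ^ n) / (n + 1) + b * (real (n + 2) * (1 + x) ^ (n + 1)) / (n + 2)))
        (at x within {-1..1})"
      by (rule derivative_eq_intros refl | simp)+
    also have "a * (real (n + 1) * (1 + x) ^ n) / (n + 1) = a * (1 + x) ^ n"
      by (simp del: of_nat_add of_nat_Suc)
    also have "b * (real (n + 2) * (1 + x) ^ (n + 1)) / (n + 2) = b * (1 + x) ^ (n + 1)"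
      by (simp del: of_nat_add of_nat_Suc)
    also have "c * (a * (1 + x) ^ n + b * (1 + x) ^ (n + 1)) = (1 + x) ^ n * (a + b * (1 + x)) * c"
      by (simp add: algebra_simps)
    finally show "(?G has_vector_derivative (1 + x) ^ n * (a + b * (1 + x)) * c) (at x within {-1..1})"
      by (simp add: has_real_derivative_iff_has_vector_derivative)
  qed simp
  \<comment> \<open>In HOL \<open>0 powr y\<close> is 0 for every y, including y = 0. So the
    integrand may differ from the polynomial one at x = 1, and for n = 0 also at x = -1; two points
    do not affect the integral.\<close>
  then have "((\<lambda>x. (1 - x) powr 0 * (1 + x) powr real n * (a + b * (1 + x)) * c) has_integral
      ?G 1 - ?G (-1)) {-1..1}"
    by (rule has_integral_spike_finite[of "{-1, 1}", rotated 2]) (auto simp: powr_realpow)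
  then show ?thesis
    by simp
qed

text \<open>Polynomials of degree below 1 are constants, so orthogonality is one linear equation in
  the two coefficients. The value 1 at x = 1 is a second one, and together they have exactly one
  solution.\<close>

lemma jacobi_poly_1:
  "jacobi_poly 1 0 (real n) = [:- real n / 2, (real n + 2) / 2:]" (is "_ = ?p")
proof -
  have linear_form: "poly [:c0, c1:] x = (c0 - c1) + c1 * (1 + x)" for c0 c1 x :: real
    by (simp add: algebra_simps)
  have orth: "((\<lambda>x. (1 - x) powr 0 * (1 + x) powr real n * poly [:c0, c1:] x * c) has_integral
      c * ((c0 - c1) * 2 ^ (n + 1) / (n + 1) + c1 * 2 ^ (n + 2) / (n + 2))) {-1..1}" for c0 c1 c
    unfolding linear_form by (rule has_integral_jacobi_weight_linear)
  \<comment> \<open>Over the common denominator, orthogonality to constants becomes (c0 - c1) * (n +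
    2) + 2 * c1 * (n + 1) = 0. Both existence and uniqueness use this form.\<close>
  have powers: "(c0 - c1) * 2 ^ (n + 1) / (n + 1) + c1 * 2 ^ (n + 2) / (n + 2) =
      2 ^ (n + 1) * ((c0 - c1) * (n + 2) + 2 * c1 * (n + 1)) / (real (n + 1) * real (n + 2))" for c0 c1 :: real
  proof -
    have "real (n + 1) \<noteq> 0" "real (n + 2) \<noteq> 0"
      by linarith+
    then show ?thesis
      by (simp only: add_frac_eq not_False_eq_True) (simp add: algebra_simps)
  qed
  show ?thesis
    unfolding jacobi_poly_def
  proof (rule the_equality, intro conjI allI impI)
    show "degree ?p = 1" "poly ?p 1 = pochhammer (0 + 1) 1 / fact 1"
      by (simp_all add: field_simps)
    fix q :: "real poly" assume "degree q < 1"
    then obtain c where q: "q = [:c:]"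
      using degree_eq_zeroE[of q] by auto
    have "(- real n / 2 - (real n + 2) / 2) * (n + 2) + 2 * ((real n + 2) / 2) * (n + 1) = 0"
      by (simp add: field_simps)
    then show "((\<lambda>x. (1 - x) powr 0 * (1 + x) powr real n * poly ?p x * poly q x) has_integral 0) {-1..1}"
      using orth[of "- real n / 2" "(real n + 2) / 2" c] unfolding powers q by simp
  next
    fix p :: "real poly"
    assume p: "degree p = 1 \<and>
        (\<forall>q. degree q < 1 \<longrightarrow> ((\<lambda>x. (1 - x) powr 0 * (1 + x) powr real n * poly p x * poly q x)
            has_integral 0) {-1..1}) \<and>
        poly p 1 = pochhammer (0 + 1) 1 / fact 1"
    then obtain c0 c1 where p_eq: "p = [:c0, c1:]"
      using degree1_coeffs by blast
    have "((\<lambda>x. (1 - x) powr 0 * (1 + x) powr real n * poly [:c0, c1:] x * 1) has_integral 0) {-1..1}"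
      using p[THEN conjunct2, THEN conjunct1, THEN spec, of 1] unfolding p_eq by simp
    from has_integral_unique[OF this orth]
    have "(c0 - c1) * (n + 2) + 2 * c1 * (n + 1) = 0"
      unfolding powers using of_nat_0_less_iff[of "n + 1", where 'a = real] of_nat_0_less_iff[of "n + 2", where 'a = real]
      by (simp del: of_nat_add of_nat_Suc add: mult.commute)
    moreover have c0: "c0 = 1 - c1"
      using p by (simp add: p_eq)
    \<comment> \<open>With c0 = 1 - c1 the left-hand side collapses to n + 2 - 2 * c1.\<close>
    ultimately have "c1 = (real n + 2) / 2"
      by (simp add: algebra_simps)
    then show "p = ?p"
      using c0 by (simp add: p_eq field_simps)
  qed
qed


subsection \<open>Surface measure\<close>

lemma emeasure_lborel_affine_vimage:
  fixes s t :: real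
  assumes "0 < t" "A \<in> sets borel"
  shows "ennreal t * emeasure lborel ((\<lambda>x. s + t * x) -` A) = emeasure lborel A"
proof -
  have "emeasure lborel A = emeasure (density (distr lborel borel (\<lambda>x. s + t * x)) (\<lambda>_. ennreal \<bar>t\<bar>)) A"
    using assms by (subst lborel_real_affine[of t s]) auto
  also have "\<dots> = ennreal t * emeasure lborel ((\<lambda>x. s + t * x) -` A)"
    using assms by (simp add: emeasure_density_const emeasure_distr)
  finally show ?thesis
    by simp
qed

text \<open>A product measure is determined by its boxes. The preimage of a box is a box, and each
  of the \<open>card I\<close> sides contributes one factor t. Restricting to I keeps the map inside
  the product space, whose elements are \<open>undefined\<close> off I.\<close>

lemma PiM_lborel_affine:
  fixes s :: "'i \<Rightarrow> real"
  assumes "finite I" "0 < t"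
  shows "(\<Pi>\<^sub>M i\<in>I. lborel) =
    density (distr (\<Pi>\<^sub>M i\<in>I. lborel) (\<Pi>\<^sub>M i\<in>I. lborel) (\<lambda>c. \<lambda>i\<in>I. s i + t * c i)) (\<lambda>_. ennreal (t ^ card I))"
    (is "?P = density (distr ?P ?P ?g) _")
proof -
  interpret product_sigma_finite "\<lambda>_::'i. lborel :: real measure"
    by standard
  have g: "?g \<in> measurable ?P ?P"
    by measurable
  have "density (distr ?P ?P ?g) (\<lambda>_. ennreal (t ^ card I)) = ?P"
  proof (rule PiM_eqI[OF \<open>finite I\<close>])
    fix A :: "'i \<Rightarrow> real set" assume A: "\<And>i. i \<in> I \<Longrightarrow> A i \<in> sets lborel"
    have vimage: "(\<lambda>x. s i + t * x) -` A i \<in> sets lborel" if "i \<in> I" for i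
      using A[OF that] by (simp add: measurable_sets_borel[of _ lborel])
    have "?g -` Pi\<^sub>E I A \<inter> space ?P = (\<Pi>\<^sub>E i\<in>I. (\<lambda>x. s i + t * x) -` A i)"
      by (rule set_eqI) (simp add: space_PiM PiE_iff conj_commute)
    then have "emeasure (density (distr ?P ?P ?g) (\<lambda>_. ennreal (t ^ card I))) (Pi\<^sub>E I A) =
        ennreal (t ^ card I) * (\<Prod>i\<in>I. emeasure lborel ((\<lambda>x. s i + t * x) -` A i))"
      using A vimage g \<open>finite I\<close>
      by (simp add: emeasure_density_const emeasure_distr emeasure_PiM sets_PiM_I_finite)
    also have "\<dots> = (\<Prod>i\<in>I. ennreal t * emeasure lborel ((\<lambda>x. s i + t * x) -` A i))"
      using \<open>0 < t\<close> by (simp add: prod.distrib ennreal_power)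
    also have "\<dots> = (\<Prod>i\<in>I. emeasure lborel (A i))"
      using A \<open>0 < t\<close> by (intro prod.cong refl emeasure_lborel_affine_vimage) auto
    finally show "emeasure (density (distr ?P ?P ?g) (\<lambda>_. ennreal (t ^ card I))) (Pi\<^sub>E I A) =
        (\<Prod>i\<in>I. emeasure lborel (A i))" .
  qed simp
  then show ?thesis
    by (rule sym)
qed

lemma sets_surface_measure: "sets (surface_measure S) = sets borel"
  by (simp add: surface_measure_def Let_def)

text \<open>A point of the hull and an orthonormal basis of its direction space exist, which
  justifies both uses of \<open>SOME\<close> in the definition. Later computations of the measure
  rely on the properties collected here and not on which chart was chosen.\<close>

lemma obtain_surface_chart:
  fixes S :: "(real^'n) set"
  assumes "S \<noteq> {}"
  obtains a B where "a \<in> affine hull S" "finite B" "pairwise orthogonal B" "\<And>b. b \<in> B \<Longrightarrow> norm b = 1"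
    "\<And>x. x \<in> affine hull S \<longleftrightarrow> x - a \<in> span B" "int (card B) = aff_dim S"
    "surface_measure S = distr (\<Pi>\<^sub>M b\<in>B. lborel) borel (\<lambda>c. a + (\<Sum>b\<in>B. c b *\<^sub>R b))"
proof -
  define H where "H = affine hull S"
  define V where "V = {x - y | x y. x \<in> H \<and> y \<in> H}"
  define a where "a = (SOME a. a \<in> H)"
  define P where "P = (\<lambda>B::(real^'n) set. pairwise orthogonal B \<and> (\<forall>b\<in>B. norm b = 1) \<and> span B = V)"
  define B where "B = (SOME B. P B)"
  have H: "affine H"
    by (simp add: H_def)
  have a: "a \<in> H"
    unfolding a_def using assms by (simp add: H_def some_in_eq)
  have V_iff: "x \<in> V \<longleftrightarrow> x + a \<in> H" for x
  proof
    assume "x \<in> V"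
    then obtain y z where "x = y - z" "y \<in> H" "z \<in> H"
      by (auto simp: V_def)
    then show "x + a \<in> H"
      using mem_affine_3_minus[OF H a, of y z 1] by (simp add: add.commute)
  next
    assume "x + a \<in> H"
    then show "x \<in> V"
      using a by (force simp: V_def)
  qed
  have V: "V = (\<lambda>x. x - a) ` H"
    by (force simp: V_iff)
  have "subspace V"
    unfolding V by (rule affine_diffs_subspace_subtract[OF H a])
  then obtain B' where "pairwise orthogonal B'" "\<And>x. x \<in> B' \<Longrightarrow> norm x = 1" "span B' = V"
    by (rule orthonormal_basis_subspace) blast
  then have "P B'"
    by (simp add: P_def)
  then have "P B"
    unfolding B_def by (rule someI)
  then have B: "pairwise orthogonal B" "\<And>b. b \<in> B \<Longrightarrow> norm b = 1" "span B = V"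
    by (auto simp: P_def)
  then have indep: "independent B"
    using pairwise_orthogonal_independent[of B] by fastforce
  show thesis
  proof
    show "finite B"
      using indep by (rule independent_imp_finite)
    show "x \<in> affine hull S \<longleftrightarrow> x - a \<in> span B" for x
      by (simp add: B V_iff flip: H_def)
    have "aff_dim S = dim V"
      using aff_dim_dim_affine_diffs[OF H a] by (simp add: V H_def)
    also have "dim V = card B"
      using B indep by (metis dim_span_eq_card_independent)
    finally show "int (card B) = aff_dim S"
      by simp
    show "surface_measure S = distr (\<Pi>\<^sub>M b\<in>B. lborel) borel (\<lambda>c. a + (\<Sum>b\<in>B. c b *\<^sub>R b))"
      by (simp add: surface_measure_def B_def P_def V_def a_def H_def Let_def)
  qed (use a B in \<open>simp_all add: H_def\<close>)
qed

lemma measurable_chart: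
  fixes a :: "'a::euclidean_space"
  assumes "finite B"
  shows "(\<lambda>c. a + (\<Sum>b\<in>B. c b *\<^sub>R b)) \<in> borel_measurable (\<Pi>\<^sub>M b\<in>B. lborel)"
proof -
  have [measurable]: "(\<lambda>c. c b) \<in> borel_measurable (\<Pi>\<^sub>M b\<in>B. lborel)" if "b \<in> B" for b
    using measurable_component_singleton[OF that, of "\<lambda>_. lborel"] by simp
  show ?thesis
    by (intro borel_measurable_add[of "\<lambda>_. a"] borel_measurable_sum borel_measurable_scaleR) measurable
qed

lemma inner_orthonormal_sum:
  assumes "finite B" "pairwise orthogonal B" "\<And>b. b \<in> B \<Longrightarrow> norm b = 1" "b \<in> B"
  shows "(\<Sum>b\<in>B. c b *\<^sub>R b) \<bullet> b = c b"
proof -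
  have "(\<Sum>b'\<in>B. c b' *\<^sub>R b') \<bullet> b = (\<Sum>b'\<in>B. if b' = b then c b else 0)"
    unfolding inner_sum_left
  proof (rule sum.cong)
    fix b' assume "b' \<in> B"
    then show "c b' *\<^sub>R b' \<bullet> b = (if b' = b then c b else 0)"
      using assms by (auto simp: pairwise_def orthogonal_def norm_eq_1)
  qed simp
  then show ?thesis
    using assms by simp
qed

text \<open>The chart conjugates the homothety to a map acting separately on each coordinate, to
  which the product scaling applies. Pushing forward by ratio t divides an m-dimensional measure by
  t^m, and the density restores that factor.\<close>

lemma surface_measure_homothety:
  fixes S :: "(real^'n) set"
  assumes w: "w \<in> affine hull S" and "0 < t" and m: "aff_dim S = int m"
  shows "surface_measure S =
    density (distr (surface_measure S) borel (\<lambda>x. w + t *\<^sub>R (x - w))) (\<lambda>_. ennreal (t ^ m))"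
proof -
  have "S \<noteq> {}"
    using w by auto
  then obtain a B where a: "a \<in> affine hull S" and B: "finite B" "pairwise orthogonal B"
      "\<And>b. b \<in> B \<Longrightarrow> norm b = 1"
    and hull: "\<And>x. x \<in> affine hull S \<longleftrightarrow> x - a \<in> span B"
    and card: "int (card B) = aff_dim S"
    and \<sigma>: "surface_measure S = distr (\<Pi>\<^sub>M b\<in>B. lborel) borel (\<lambda>c. a + (\<Sum>b\<in>B. c b *\<^sub>R b))"
    using obtain_surface_chart by blast
  let ?P = "\<Pi>\<^sub>M b\<in>B. (lborel :: real measure)"
  let ?\<phi> = "\<lambda>c. a + (\<Sum>b\<in>B. c b *\<^sub>R b)"
  \<comment> \<open>Since h(x) - a = (1 - t) * (w - a) + t * (x - a), this is the coordinate along b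
    of the constant term. As w lies in the affine hull, w - a is recovered from its
    coordinates.\<close>
  let ?s = "\<lambda>b. (1 - t) * ((w - a) \<bullet> b)"
  let ?g = "\<lambda>c. \<lambda>b\<in>B. ?s b + t * c b"
  let ?h = "\<lambda>x. w + t *\<^sub>R (x - w)"
  have \<phi>: "?\<phi> \<in> borel_measurable ?P"
    by (rule measurable_chart[OF B(1)])
  have g: "?g \<in> measurable ?P ?P"
    by measurable
  have h: "?h \<in> borel_measurable borel"
    by measurable
  have w_eq: "(\<Sum>b\<in>B. ((w - a) \<bullet> b) *\<^sub>R b) = w - a"
    using w B by (intro orthonormal_basis_expand) (auto simp: hull)
  have "?\<phi> (?g c) = ?h (?\<phi> c)" for c
  proof -
    have "?\<phi> (?g c) = a + (1 - t) *\<^sub>R (\<Sum>b\<in>B. ((w - a) \<bullet> b) *\<^sub>R b) + t *\<^sub>R (\<Sum>b\<in>B. c b *\<^sub>R b)"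
      by (simp add: scaleR_add_left sum.distrib scaleR_sum_right)
    also have "\<dots> = ?h (?\<phi> c)"
      unfolding w_eq by (simp add: algebra_simps)
    finally show ?thesis .
  qed
  then have "distr (distr ?P ?P ?g) borel ?\<phi> = distr (surface_measure S) borel ?h"
    unfolding \<sigma> using distr_distr[OF \<phi> g] distr_distr[OF h \<phi>] by (simp add: o_def)
  moreover have "?P = density (distr ?P ?P ?g) (\<lambda>_. ennreal (t ^ m))"
    using PiM_lborel_affine[OF B(1) \<open>0 < t\<close>, of ?s] card m by simp
  then have "surface_measure S = distr (density (distr ?P ?P ?g) (\<lambda>_. ennreal (t ^ m))) borel ?\<phi>"
    unfolding \<sigma> by simp
  then have "surface_measure S = density (distr (distr ?P ?P ?g) borel ?\<phi>) (\<lambda>_. ennreal (t ^ m))"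
    using \<phi> by (subst density_distr) simp_all
  ultimately show ?thesis
    by simp
qed

text \<open>A bounded set lies in a cube of chart coordinates; a nonempty convex set contains the
  image of such a cube around a relative interior point. The facet mean depends on both bounds,
  because \<open>measure\<close> sends infinite mass to 0 and division by 0 gives 0.\<close>

lemma
  fixes S :: "(real^'n) set"
  assumes "compact S" "convex S" "S \<noteq> {}"
  shows emeasure_surface_measure_finite: "emeasure (surface_measure S) S < \<infinity>"
    and emeasure_surface_measure_pos: "0 < emeasure (surface_measure S) S"
proof -
  obtain a B where a: "a \<in> affine hull S" and B: "finite B" "pairwise orthogonal B"
      "\<And>b. b \<in> B \<Longrightarrow> norm b = 1"
    and hull: "\<And>x. x \<in> affine hull S \<longleftrightarrow> x - a \<in> span B" and "int (card B) = aff_dim S"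
    and \<sigma>: "surface_measure S = distr (\<Pi>\<^sub>M b\<in>B. lborel) borel (\<lambda>c. a + (\<Sum>b\<in>B. c b *\<^sub>R b))"
    using obtain_surface_chart[OF \<open>S \<noteq> {}\<close>] by blast
  interpret product_sigma_finite "\<lambda>_::real^'n. lborel :: real measure"
    by standard
  let ?P = "\<Pi>\<^sub>M b\<in>B. (lborel :: real measure)"
  let ?\<phi> = "\<lambda>c. a + (\<Sum>b\<in>B. c b *\<^sub>R b)"
  have S: "S \<in> sets borel"
    using \<open>compact S\<close> by (simp add: borel_compact)
  have \<phi>: "?\<phi> \<in> borel_measurable ?P"
    by (rule measurable_chart[OF B(1)])
  have meas: "?\<phi> -` S \<inter> space ?P \<in> sets ?P"
    by (rule measurable_sets[OF \<phi> S])
  have \<sigma>S: "emeasure (surface_measure S) S = emeasure ?P (?\<phi> -` S \<inter> space ?P)"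
    unfolding \<sigma> by (rule emeasure_distr[OF \<phi> S])
  have coord: "(?\<phi> c - a) \<bullet> b = c b" if "b \<in> B" for b c
    using inner_orthonormal_sum[OF B that] by simp
  have emeasure_box: "emeasure ?P (\<Pi>\<^sub>E b\<in>B. {f b - r..f b + r}) = ennreal (\<Prod>b\<in>B. 2 * r)" if "0 \<le> r" for f r
    using that B(1) by (simp add: emeasure_PiM ennreal_power prod_constant)
  have "bounded ((\<lambda>x. x - a) ` S)"
    using compact_imp_bounded[OF \<open>compact S\<close>] by (rule bounded_translation_minus)
  then obtain R where "0 < R" and R: "\<And>x. x \<in> S \<Longrightarrow> norm (x - a) \<le> R"
    unfolding bounded_pos by auto
  then have "0 \<le> R"
    by simp
  have "?\<phi> -` S \<inter> space ?P \<subseteq> (\<Pi>\<^sub>E b\<in>B. {0 - R..0 + R})"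
  proof
    fix c assume c: "c \<in> ?\<phi> -` S \<inter> space ?P"
    have "\<bar>c b\<bar> \<le> R" if "b \<in> B" for b
      using Cauchy_Schwarz_ineq2[of "?\<phi> c - a" b] R[of "?\<phi> c"] c B(3)[OF that] coord[OF that, of c] by simp
    then show "c \<in> (\<Pi>\<^sub>E b\<in>B. {0 - R..0 + R})"
      using c by (auto simp: space_PiM PiE_iff abs_le_iff minus_le_iff)
  qed
  then have "emeasure ?P (?\<phi> -` S \<inter> space ?P) \<le> emeasure ?P (\<Pi>\<^sub>E b\<in>B. {0 - R..0 + R})"
    using B(1) by (intro emeasure_mono sets_PiM_I_finite) auto
  also have "\<dots> < \<infinity>"
    unfolding emeasure_box[OF \<open>0 \<le> R\<close>] by simp
  finally show "emeasure (surface_measure S) S < \<infinity>"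
    unfolding \<sigma>S .

  obtain x e where x: "x \<in> S" and "0 < e" and e: "ball x e \<inter> affine hull S \<subseteq> S"
    using rel_interior_eq_empty[OF \<open>convex S\<close>] \<open>S \<noteq> {}\<close> mem_rel_interior_ball by blast
  have x_eq: "x = ?\<phi> (\<lambda>b. (x - a) \<bullet> b)"
    using orthonormal_basis_expand[OF B(2,3) _ B(1), of "x - a"] hull_inc[OF x, of affine] by (simp add: hull)
  \<comment> \<open>Displacements of at most r along each of the \<open>card B\<close> unit
    directions move the point by at most \<open>card B\<close> * r, which is below e. The added 1
    gives strictness and covers the empty basis.\<close>
  define r where "r = e / (card B + 1)"
  have "0 < r"
    using \<open>0 < e\<close> by (simp add: r_def)
  have "(\<Pi>\<^sub>E b\<in>B. {(x - a) \<bullet> b - r..(x - a) \<bullet> b + r}) \<subseteq> ?\<phi> -` S \<inter> space ?P"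
  proof
    fix c assume c: "c \<in> (\<Pi>\<^sub>E b\<in>B. {(x - a) \<bullet> b - r..(x - a) \<bullet> b + r})"
    have "?\<phi> c - x = (\<Sum>b\<in>B. (c b - (x - a) \<bullet> b) *\<^sub>R b)"
      by (subst x_eq) (simp add: scaleR_diff_left sum_subtractf)
    also have "norm \<dots> \<le> (\<Sum>b\<in>B. r)"
    proof (rule sum_norm_le)
      fix b assume "b \<in> B"
      then have "(x - a) \<bullet> b - r \<le> c b \<and> c b \<le> (x - a) \<bullet> b + r"
        using c by (auto simp: PiE_iff)
      then have "\<bar>c b - (x - a) \<bullet> b\<bar> \<le> r"
        by linarith
      then show "norm ((c b - (x - a) \<bullet> b) *\<^sub>R b) \<le> r"
        using B(3)[OF \<open>b \<in> B\<close>] by simp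
    qed
    also have "\<dots> < e"
      using \<open>0 < e\<close> by (simp add: r_def field_simps)
    finally have "?\<phi> c \<in> ball x e"
      by (simp add: dist_norm norm_minus_commute)
    moreover have "?\<phi> c \<in> affine hull S"
      unfolding hull by (simp add: span_sum span_scale span_base)
    ultimately show "c \<in> ?\<phi> -` S \<inter> space ?P"
      using e c by (auto simp: space_PiM PiE_iff)
  qed
  then have "emeasure ?P (\<Pi>\<^sub>E b\<in>B. {(x - a) \<bullet> b - r..(x - a) \<bullet> b + r}) \<le> emeasure (surface_measure S) S"
    unfolding \<sigma>S using meas by (rule emeasure_mono)
  moreover have "0 < emeasure ?P (\<Pi>\<^sub>E b\<in>B. {(x - a) \<bullet> b - r..(x - a) \<bullet> b + r})"
    using \<open>0 < r\<close> emeasure_box[of r "\<lambda>b. (x - a) \<bullet> b"] by simp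
  ultimately show "0 < emeasure (surface_measure S) S"
    by (rule less_le_trans[rotated])
qed


subsection \<open>Facet means of barycentric coordinates\<close>

lemma integral_surface_measure_homothety:
  fixes S :: "(real^'n) set" and f :: "real^'n \<Rightarrow> real"
  assumes "w \<in> affine hull S" "0 < t" "aff_dim S = int m" and f: "f \<in> borel_measurable borel"
  shows "(\<integral>x. f x \<partial>surface_measure S) = t ^ m * (\<integral>x. f (w + t *\<^sub>R (x - w)) \<partial>surface_measure S)"
proof -
  have h: "(\<lambda>x. w + t *\<^sub>R (x - w)) \<in> measurable (surface_measure S) borel"
    by (subst measurable_cong_sets[OF sets_surface_measure refl]) simp
  have "(\<integral>x. f x \<partial>surface_measure S) =
      (\<integral>x. f x \<partial>density (distr (surface_measure S) borel (\<lambda>x. w + t *\<^sub>R (x - w))) (\<lambda>_. ennreal (t ^ m)))"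
    using surface_measure_homothety[OF assms(1-3)] by simp
  also have "\<dots> = (\<integral>x. t ^ m * f (w + t *\<^sub>R (x - w)) \<partial>surface_measure S)"
    using f h \<open>0 < t\<close> by (simp add: integral_density integral_distr)
  finally show ?thesis
    by simp
qed

context full_simplex
begin

lemma aff_dim_facet:
  assumes "u \<in> C"
  shows "aff_dim (convex hull (C - {u})) = int (CARD('n) - 1)"
proof -
  have "\<not> affine_dependent (C - {u})"
    using indep by (rule affine_independent_Diff)
  then show ?thesis
    using assms aff_dim_affine_independent[of "C - {u}"] finite_vertices card_vertices
    by (simp add: aff_dim_convex_hull)
qed

text \<open>The homothety with centre \<open>w\<close> and ratio \<open>t\<close> maps the facet onto its part where the
  coordinate of \<open>w\<close> is at least \<open>1 - t\<close>, and on the rest that coordinate is at most \<open>1 - t\<close>.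
  Comparing the integrals squeezes the mean as \<open>t\<close> tends to \<open>1\<close>.\<close>

lemma
  assumes u: "u \<in> C" and w: "w \<in> C" "w \<noteq> u"
  defines "F \<equiv> convex hull (C - {u})"
  shows set_integrable_barycentric_facet:
      "set_integrable (surface_measure F) F (barycentric (convex hull C) w)" (is ?integrable)
    and integral_barycentric_facet:
      "(LINT x:F|surface_measure F. barycentric (convex hull C) w x) =
        measure (surface_measure F) F / CARD('n)" (is ?integral)
proof -
  let ?l = "barycentric (convex hull C) w"
  define \<sigma> where "\<sigma> = surface_measure F"
  define m where "m = CARD('n) - 1"
  define I where "I = (\<integral>x. indicator F x * ?l x \<partial>\<sigma>)"
  define M where "M = measure \<sigma> F"
  have wF: "w \<in> F"
    using w by (auto simp: F_def intro: hull_inc)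
  have dimF: "aff_dim F = int m"
    unfolding F_def m_def by (rule aff_dim_facet[OF u])
  have compF: "compact F"
    unfolding F_def by (intro finite_imp_compact_convex_hull) (simp add: finite_vertices)
  have sets_\<sigma> [simp]: "sets \<sigma> = sets borel"
    by (simp add: \<sigma>_def sets_surface_measure)
  have [measurable_cong]: "sets \<sigma> = sets borel"
    by simp
  have F [measurable]: "F \<in> sets borel"
    using compF by (rule borel_compact)
  have l [measurable]: "?l \<in> borel_measurable borel"
    by (intro borel_measurable_continuous_onI continuous_on_barycentric w)
  have fin: "emeasure \<sigma> F < \<infinity>"
    unfolding \<sigma>_def using compF wF
    by (intro emeasure_surface_measure_finite) (simp add: F_def, simp add: F_def, blast)
  have memF: "x \<in> F \<longleftrightarrow> (\<forall>v\<in>C. 0 \<le> barycentric (convex hull C) v x) \<and> barycentric (convex hull C) u x = 0" for x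
    unfolding F_def using u by (subst mem_face_iff) auto
  have l_bounds: "0 \<le> ?l x" "?l x \<le> 1" if "x \<in> F" for x
  proof -
    show "0 \<le> ?l x"
      using that w by (simp add: memF)
    have "?l x \<le> (\<Sum>v\<in>C. barycentric (convex hull C) v x)"
      using that w finite_vertices by (intro member_le_sum) (auto simp: memF)
    then show "?l x \<le> 1"
      by (simp add: sum_barycentric)
  qed
  have integrable_indicator: "integrable \<sigma> (indicator A :: _ \<Rightarrow> real)"
    if "A \<in> sets borel" "A \<subseteq> F" for A
    using that fin le_less_trans[OF emeasure_mono[of A F \<sigma>]] by (intro integrable_real_indicator) auto
  have integrable_l: "integrable \<sigma> (\<lambda>x. indicator A x * ?l x)"
    if [measurable]: "A \<in> sets borel" and "A \<subseteq> F" for A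
  proof (rule Bochner_Integration.integrable_bound[OF integrable_indicator[OF that]])
    show "(\<lambda>x. indicator A x * ?l x) \<in> borel_measurable \<sigma>"
      by measurable
    show "AE x in \<sigma>. norm (indicator A x * ?l x) \<le> norm (indicator A x :: real)"
      using l_bounds \<open>A \<subseteq> F\<close> by (intro AE_I2) (auto simp: indicator_def)
  qed
  from integrable_l[of F] show ?integrable
    by (simp add: set_integrable_def \<sigma>_def)
  \<comment> \<open>The bounded expression is the integral of \<open>?l\<close> over the part of F
    outside the homothetic copy, divided by 1 - t. The geometric sum carries out that division
    beforehand, so the limit at t = 1 is mere continuity.\<close>
  have bounds: "0 \<le> I * (\<Sum>i<Suc m. t ^ i) - t ^ m * M" "I * (\<Sum>i<Suc m. t ^ i) - t ^ m * M \<le> (1 - t ^ m) * M"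
    if t: "0 < t" "t < 1" for t
  proof -
    let ?h = "\<lambda>x. w + t *\<^sub>R (x - w)"
    define G where "G = {x \<in> F. 1 - t \<le> ?l x}"
    have G [measurable]: "G \<in> sets borel"
      unfolding G_def by measurable
    have GF: "G \<subseteq> F"
      by (auto simp: G_def)
    have lh: "?l (?h x) = t * ?l x + (1 - t)" for x
      using w by (simp add: barycentric_homothety barycentric_vertex)
    have bh: "barycentric (convex hull C) v (?h x) = t * barycentric (convex hull C) v x"
      if "v \<in> C" "v \<noteq> w" for v x
      using w that by (simp add: barycentric_homothety barycentric_vertex)
    \<comment> \<open>Every coordinate other than that of w is multiplied by t > 0, which preserves
      sign and vanishing. For w, the condition 0 \<le> \<open>?l x\<close> is equivalent to 1 - t
      \<le> \<open>?l (?h x)\<close>.\<close>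
    have hG: "?h x \<in> G \<longleftrightarrow> x \<in> F" for x
    proof
      assume "?h x \<in> G"
      then have *: "\<And>v. v \<in> C \<Longrightarrow> 0 \<le> barycentric (convex hull C) v (?h x)"
        and **: "barycentric (convex hull C) u (?h x) = 0" "1 - t \<le> ?l (?h x)"
        by (auto simp: G_def memF)
      have "0 \<le> barycentric (convex hull C) v x" if "v \<in> C" for v
        using *[OF that] bh[OF that] **(2) t by (cases "v = w") (auto simp: lh zero_le_mult_iff)
      moreover have "barycentric (convex hull C) u x = 0"
        using **(1) bh[OF u] w t by auto
      ultimately show "x \<in> F"
        by (simp add: memF)
    next
      assume "x \<in> F"
      then have *: "\<And>v. v \<in> C \<Longrightarrow> 0 \<le> barycentric (convex hull C) v x"
        and **: "barycentric (convex hull C) u x = 0"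
        by (auto simp: memF)
      have "0 \<le> barycentric (convex hull C) v (?h x)" if "v \<in> C" for v
        using *[OF that] bh[OF that] t by (cases "v = w") (auto simp: lh)
      moreover have "barycentric (convex hull C) u (?h x) = 0"
        using ** bh[OF u] w by auto
      ultimately show "?h x \<in> G"
        using t *[OF w(1)] by (simp add: G_def memF lh)
    qed
    have scale: "(\<integral>x. f x \<partial>\<sigma>) = t ^ m * (\<integral>x. f (?h x) \<partial>\<sigma>)"
      if "f \<in> borel_measurable borel" for f :: "_ \<Rightarrow> real"
      unfolding \<sigma>_def
      using wF t(1) dimF that by (intro integral_surface_measure_homothety) (auto intro: hull_inc)
    have indG: "indicator G (?h x) = (indicator F x :: real)" for x
      by (simp add: indicator_def hG)
    \<comment> \<open>Pulling back replaces G by F and \<open>?l\<close> by t * \<open>?l\<close> +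
      (1 - t), so the integral over the copy is expressed through I itself.\<close>
    have "(\<integral>x. indicator G x * ?l x \<partial>\<sigma>) = t ^ m * (\<integral>x. indicator G (?h x) * ?l (?h x) \<partial>\<sigma>)"
      by (rule scale) measurable
    also have "(\<integral>x. indicator G (?h x) * ?l (?h x) \<partial>\<sigma>) =
        (\<integral>x. t * (indicator F x * ?l x) + (1 - t) * indicator F x \<partial>\<sigma>)"
      unfolding indG lh by (simp add: algebra_simps)
    also have "\<dots> = t * I + (1 - t) * M"
      using integrable_l[of F] integrable_indicator[of F] by (simp add: I_def M_def)
    finally have IG: "(\<integral>x. indicator G x * ?l x \<partial>\<sigma>) = t ^ m * (t * I + (1 - t) * M)" .
    have "(\<integral>x. indicator G x \<partial>\<sigma>) = t ^ m * (\<integral>x. indicator G (?h x) \<partial>\<sigma>)"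
      by (rule scale) measurable
    then have MG: "(\<integral>x. indicator G x \<partial>\<sigma>) = t ^ m * M"
      unfolding indG by (simp add: M_def)
    have split: "indicator F x = indicator G x + (indicator (F - G) x :: real)" for x
      using GF by (auto simp: indicator_def)
    have "I = (\<integral>x. indicator G x * ?l x + indicator (F - G) x * ?l x \<partial>\<sigma>)"
      unfolding I_def split by (simp add: algebra_simps)
    also have "\<dots> = t ^ m * (t * I + (1 - t) * M) + (\<integral>x. indicator (F - G) x * ?l x \<partial>\<sigma>)"
      using GF by (subst Bochner_Integration.integral_add) (auto intro!: integrable_l simp: IG)
    finally have I_split: "I = t ^ m * (t * I + (1 - t) * M) + (\<integral>x. indicator (F - G) x * ?l x \<partial>\<sigma>)" .
    have "M = (\<integral>x. indicator G x + indicator (F - G) x \<partial>\<sigma>)"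
      unfolding split[symmetric] by (simp add: M_def)
    also have "\<dots> = t ^ m * M + (\<integral>x. indicator (F - G) x \<partial>\<sigma>)"
      unfolding MG[symmetric]
      using GF by (intro Bochner_Integration.integral_add integrable_indicator) auto
    finally have M: "(\<integral>x. indicator (F - G) x \<partial>\<sigma>) = (1 - t ^ m) * M"
      by (simp add: algebra_simps)
    have eq: "(1 - t) * (I * (\<Sum>i<Suc m. t ^ i) - t ^ m * M) = (\<integral>x. indicator (F - G) x * ?l x \<partial>\<sigma>)"
    proof -
      have "(1 - t) * (I * (\<Sum>i<Suc m. t ^ i) - t ^ m * M) = I * (1 - t ^ Suc m) - t ^ m * (1 - t) * M"
        unfolding one_diff_power_eq by (simp add: algebra_simps)
      also have "\<dots> = I - t ^ m * (t * I + (1 - t) * M)"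
        by (simp add: algebra_simps)
      finally show ?thesis
        using I_split by simp
    qed
    have "0 \<le> (\<integral>x. indicator (F - G) x * ?l x \<partial>\<sigma>)"
      by (intro Bochner_Integration.integral_nonneg) (auto simp: indicator_def l_bounds)
    then show "0 \<le> I * (\<Sum>i<Suc m. t ^ i) - t ^ m * M"
      unfolding eq[symmetric] using t by (simp add: zero_le_mult_iff)
    have "(\<integral>x. indicator (F - G) x * ?l x \<partial>\<sigma>) \<le> (\<integral>x. (1 - t) * indicator (F - G) x \<partial>\<sigma>)"
    proof (rule integral_mono)
      show "integrable \<sigma> (\<lambda>x. indicator (F - G) x * ?l x)"
        by (rule integrable_l) auto
      show "integrable \<sigma> (\<lambda>x. (1 - t) * indicator (F - G) x)"
        by (intro integrable_mult_right integrable_indicator) auto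
    qed (auto simp: indicator_def G_def)
    also have "\<dots> = (1 - t) * ((1 - t ^ m) * M)"
      by (simp only: integral_mult_right_zero M)
    finally show "I * (\<Sum>i<Suc m. t ^ i) - t ^ m * M \<le> (1 - t ^ m) * M"
      unfolding eq[symmetric] using t by simp
  qed
  let ?q = "\<lambda>t::real. I * (\<Sum>i<Suc m. t ^ i) - t ^ m * M"
  have near: "eventually (\<lambda>t. 0 < t \<and> t < 1) (at_left (1::real))"
    using eventually_at_left_real[of 0 1] by simp
  have "(?q \<longlongrightarrow> I * (\<Sum>i<Suc m. 1 ^ i) - 1 ^ m * M) (at_left 1)"
    by (intro tendsto_intros)
  then have q: "(?q \<longlongrightarrow> I * Suc m - M) (at_left 1)"
    by simp
  \<comment> \<open>The upper bound tends to 0, so the two estimates force I * (m + 1) = M, where m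
    + 1 = d.\<close>
  have "((\<lambda>t. (1 - t ^ m) * M) \<longlongrightarrow> (1 - 1 ^ m) * M) (at_left (1::real))"
    by (intro tendsto_intros)
  then have "I * Suc m - M \<le> (1 - 1 ^ m) * M"
  proof (rule tendsto_le[OF _ _ q, rotated])
    show "eventually (\<lambda>t. ?q t \<le> (1 - t ^ m) * M) (at_left 1)"
      using near by (rule eventually_mono) (blast intro: bounds(2))
  qed simp
  moreover have "0 \<le> I * Suc m - M"
  proof (rule tendsto_lowerbound[OF q])
    show "eventually (\<lambda>t. 0 \<le> ?q t) (at_left 1)"
      using near by (rule eventually_mono) (blast intro: bounds(1))
  qed simp
  ultimately have "I * Suc m = M"
    by simp
  then have "I = M / CARD('n)"
    by (simp add: m_def field_simps)
  then show ?integral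
    by (simp add: I_def M_def \<sigma>_def set_lebesgue_integral_def)
qed

end


subsection \<open>Crouzeix--Raviart functions of order one\<close>

text \<open>For d \<ge> 2 the exponent d - 2 is a natural number, as the explicit form of the Jacobi
  polynomial demands. The argument 1 - 2 * x turns its slope d / 2 into -d, and x = 0 gives the
  normalization value 1.\<close>

lemma CR_jacobi_1:
  assumes "2 \<le> d"
  shows "CR_jacobi d 1 (1 - 2 * x) = 1 - real d * x"
proof -
  have "real d - 2 = real (d - 2)" "real (d - 2) + 2 = real d"
    using assms by (simp_all add: of_nat_diff)
  then show ?thesis
    unfolding CR_jacobi_def by (simp only: jacobi_poly_1) (simp add: field_simps)
qed

lemma (in full_simplex) CR_simplex_1:
  assumes "CARD('n) \<ge> 2"
  shows "CR_simplex 1 (convex hull C) (convex hull C) x = 0"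
  using assms
  by (simp add: CR_simplex_def vertices_eq CR_jacobi_1 sum_subtractf sum_barycentric card_vertices
      flip: sum_distrib_left del: One_nat_def)

lemma (in full_simplex) facet_mean_CR:
  assumes F: "F facet_of convex hull C" and F': "F' facet_of convex hull C"
  shows "facet_mean F (\<lambda>x. 1 - real CARD('n) * barycentric_facet (convex hull C) F' x) =
    (if F = F' then 1 else 0)"
proof -
  obtain u where u: "u \<in> C" "F = convex hull (C - {u})"
    using F by (auto simp: facet_of_convex_hull_affine_independent indep)
  obtain w where w: "w \<in> C" "F' = convex hull (C - {w})"
    using F' by (auto simp: facet_of_convex_hull_affine_independent indep)
  let ?\<sigma> = "surface_measure F"
  let ?l = "barycentric (convex hull C) w"
  have l: "barycentric_facet (convex hull C) F' = ?l"
    using w by (simp add: barycentric_facet_def opposite_vertex_eq)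
  have "F \<noteq> {}"
    using F by (simp add: facet_of_def)
  have compF: "compact F" and convF: "convex F"
    using u finite_vertices by (auto intro!: finite_imp_compact_convex_hull)
  have fin: "emeasure ?\<sigma> F < \<infinity>" and pos: "0 < measure ?\<sigma> F"
    using emeasure_surface_measure_finite[OF compF convF \<open>F \<noteq> {}\<close>]
      emeasure_surface_measure_pos[OF compF convF \<open>F \<noteq> {}\<close>]
    by (auto simp: measure_def enn2real_positive_iff)
  have F_sets: "F \<in> sets ?\<sigma>"
    using borel_compact[OF compF] by (simp add: sets_surface_measure)
  have int1: "set_integrable ?\<sigma> F (\<lambda>x. 1::real)"
    using fin F_sets by (simp add: set_integrable_def)
  have one: "(LINT x:F|?\<sigma>. 1) = measure ?\<sigma> F"
    using F_sets by (simp add: set_lebesgue_integral_def)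
  show ?thesis
  proof (cases "F = F'")
    case True
    then have "?l x = 0" if "x \<in> F" for x
      using that w mem_face_iff[of "C - {w}" x] by auto
    then have "(LINT x:F|?\<sigma>. 1 - real CARD('n) * ?l x) = (LINT x:F|?\<sigma>. 1)"
      using F_sets by (intro set_lebesgue_integral_cong) auto
    then have "facet_mean F (\<lambda>x. 1 - real CARD('n) * ?l x) = 1"
      unfolding facet_mean_def one using pos by simp
    then show ?thesis
      using True by (simp add: l)
  next
    case False
    \<comment> \<open>Distinct facets of one simplex omit distinct vertices. Hence w is a vertex of
      F and its coordinate has mean 1 / d there, so the integral of 1 - d * \<open>?l\<close>
      vanishes.\<close>
    then have "w \<noteq> u"
      using u w by auto
    have "set_integrable ?\<sigma> F (\<lambda>x. real CARD('n) * ?l x)"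
      using set_integrable_barycentric_facet[OF u(1) w(1) \<open>w \<noteq> u\<close>] u(2)
      by (intro set_integrable_mult_right) simp
    then have "(LINT x:F|?\<sigma>. 1 - real CARD('n) * ?l x) =
        (LINT x:F|?\<sigma>. 1) - real CARD('n) * (LINT x:F|?\<sigma>. ?l x)"
      using set_integral_diff(2)[OF int1] by simp
    also have "\<dots> = 0"
      using integral_barycentric_facet[OF u(1) w(1) \<open>w \<noteq> u\<close>] by (simp add: one u(2)[symmetric])
    finally show ?thesis
      using False by (simp add: facet_mean_def l)
  qed
qed

lemma simplex_imp_full_simplex:
  fixes K :: "(real^'n) set"
  assumes "int CARD('n) simplex K"
  obtains C where "full_simplex C" "K = convex hull C"
proof -
  obtain C where "\<not> affine_dependent C" "int (card C) = int CARD('n) + 1" "K = convex hull C"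
    using assms by (auto simp: simplex_def)
  then show thesis
    by (intro that[of C]) (auto simp: full_simplex_def)
qed

text \<open>Conformity enters here, since \<open>simplices_at\<close> asks only for containment. F
  is a facet of some K' and lies in the common face of K and K'; hence it is a face of that
  intersection, thus of K, and its dimension is right because K and K' have the same
  dimension.\<close>

lemma facet_of_simplices_at:
  fixes \<T> :: "(real^'n) set set"
  assumes mesh: "conforming_simplicial_mesh \<Omega> \<T>" and F: "F \<in> mesh_facets \<T>"
    and K: "K \<in> simplices_at \<T> F"
  shows "F facet_of K"
proof -
  obtain K' where K': "K' \<in> \<T>" "F facet_of K'"
    using F by (auto simp: mesh_facets_def)
  have "K \<in> \<T>" "F \<subseteq> K"
    using K by (auto simp: simplices_at_def)
  then have face: "(K \<inter> K') face_of K" "(K \<inter> K') face_of K'"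
    and dim: "aff_dim K = int CARD('n)" "aff_dim K' = int CARD('n)"
    using mesh K'(1) aff_dim_simplex unfolding conforming_simplicial_mesh_def by blast+
  have F': "F face_of K'" "F \<noteq> {}" "aff_dim F = aff_dim K' - 1"
    using K' by (auto simp: facet_of_def)
  have "F face_of K \<inter> K'"
    using F'(1) face_of_face[OF face(2)] \<open>F \<subseteq> K\<close> face_of_imp_subset by blast
  then have "F face_of K"
    using face_of_face[OF face(1)] by blast
  then show ?thesis
    using F' dim by (simp add: facet_of_def)
qed

text \<open>Quantifying over every K in \<open>simplices_at \<T> F\<close> expresses that the trace
  may be taken from either side. If K also contains F', both are facets of K and the mean is
  computed inside one simplex. Otherwise the piece on K is zero, and F = F' is impossible because K
  contains only one of them.\<close>

theorem lemma33:
  fixes \<Omega> :: "(real^'n) set" and \<T> :: "(real^'n) set set"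
  assumes "CARD('n) \<ge> 2"
    and "bounded_lipschitz_polytope \<Omega>"
    and "conforming_simplicial_mesh \<Omega> \<T>"
  shows "(\<forall>F\<in>mesh_facets \<T>. \<forall>K\<in>\<T>. \<forall>x\<in>K.
            CR_facet \<T> 1 F K x =
              (if K \<in> simplices_at \<T> F
               then poly (jacobi_poly 1 0 (real CARD('n) - 2)) (1 - 2 * barycentric_facet K F x)
               else 0))
       \<and> (\<forall>F\<in>mesh_facets \<T>. \<forall>F'\<in>mesh_facets \<T>. \<forall>K\<in>simplices_at \<T> F.
            facet_mean F (CR_facet \<T> 1 F' K) = (if F = F' then 1 else 0))"
proof -
  have CR: "CR_facet \<T> 1 F K x =
      (if K \<in> simplices_at \<T> F then CR_jacobi CARD('n) 1 (1 - 2 * barycentric_facet K F x) else 0)"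
    if "K \<in> \<T>" for F K x
  proof -
    have "int CARD('n) simplex K"
      using assms(3) that by (simp add: conforming_simplicial_mesh_def)
    then obtain C where "full_simplex C" "K = convex hull C"
      by (rule simplex_imp_full_simplex)
    then show ?thesis
      using full_simplex.CR_simplex_1[of C x] assms(1) by (simp add: CR_facet_def)
  qed
  have "facet_mean F (CR_facet \<T> 1 F' K) = (if F = F' then 1 else 0)"
    if F: "F \<in> mesh_facets \<T>" and F': "F' \<in> mesh_facets \<T>" and K: "K \<in> simplices_at \<T> F" for F F' K
  proof (cases "K \<in> simplices_at \<T> F'")
    case True
    have "K \<in> \<T>"
      using K by (simp add: simplices_at_def)
    then have "int CARD('n) simplex K"
      using assms(3) by (simp add: conforming_simplicial_mesh_def)
    then obtain C where C: "full_simplex C" "K = convex hull C"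
      by (rule simplex_imp_full_simplex)
    have "CR_facet \<T> 1 F' K = (\<lambda>x. 1 - real CARD('n) * barycentric_facet K F' x)"
      using True by (simp add: fun_eq_iff CR[OF \<open>K \<in> \<T>\<close>] CR_jacobi_1[OF assms(1)] del: One_nat_def)
    then show ?thesis
      using full_simplex.facet_mean_CR[OF C(1), of F F'] facet_of_simplices_at[OF assms(3)] F F' K True
      by (simp add: C(2))
  next
    case False
    then have "F \<noteq> F'"
      using K by auto
    then show ?thesis
      using False by (simp add: CR_facet_def[abs_def] facet_mean_def)
  qed
  then show ?thesis
    using CR by (auto simp: CR_jacobi_def)
qed

end
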